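(* Let $\mathcal{C}$ be a uniform clutter without isolated vertices on the vertex set $X=\{x_1,\ldots,x_n\}$, let $A$ be its incidence matrix, and let $\mathcal{A}=\{v_1,\ldots,v_q\}\subset\mathbb{N}^n$ be the set of columns of $A$. If $\mathcal{C}$ has the max-flow min-cut property, then (a) $\Delta_r(A)=1$, where $r=\mathrm{rank}(A)$; (b) $\mathbb{N}\mathcal{A}=\mathbb{R}_+\mathcal{A}\cap\mathbb{Z}^n$.
   Context: A clutter with finite vertex set $X$ is a family of subsets of $X$ (edges), none of which is included in another. It is uniform if all its edges have the same number $d\geq 1$ of vertices. A vertex is isolated if it lies in no edge. The incidence matrix is the vertex-edge $\{0,1\}$-matrix whose columns are the characteristic vectors of the edges. $\mathcal{C}$ has the max-flow min-cut property if both sides of the LP-duality equation $$\min\{\langle\alpha,x\rangle\mid x\geq 0;\ xA\geq\mathbf{1}\}=\max\{\langle y,\mathbf{1}\rangle\mid y\geq 0;\ Ay\leq\alpha\}$$ have integral optimum solutions $x$ and $y$ for each non-negative integral vector $\alpha$; here $\mathbf{1}$ is the all-ones vector. $\Delta_r(A)$ is the greatest common divisor of all the nonzero $r\times r$ subdeterminants of $A$. $\mathbb{N}\mathcal{A}$ is the semigroup of non-negative integer combinations of $\mathcal{A}$ and $\mathbb{R}_+\mathcal{A}$ the cone of non-negative real combinations. *)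

theory Defs
  imports
    Complex_Main
    Jordan_Normal_Form.DL_Rank
    Jordan_Normal_Form.DL_Submatrix
begin

definition clutter :: "'a set \<Rightarrow> 'a set set \<Rightarrow> bool" where
  "clutter X E \<longleftrightarrow>
     finite X \<and> (\<forall>e\<in>E. e \<subseteq> X) \<and> (\<forall>e\<in>E. \<forall>f\<in>E. e \<subseteq> f \<longrightarrow> e = f)"

definition uniform_clutter :: "'a set \<Rightarrow> 'a set set \<Rightarrow> bool" where
  "uniform_clutter X E \<longleftrightarrow> clutter X E \<and> (\<exists>d\<ge>1. \<forall>e\<in>E. card e = d)"

definition isolated_vertex :: "'a set set \<Rightarrow> 'a \<Rightarrow> bool" where
  "isolated_vertex E x \<longleftrightarrow> (\<forall>e\<in>E. x \<notin> e)"

(* The lists enumerate the vertices and the edges, without repetition;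
   they fix the order of the rows and of the columns. *)
definition incidence_mat :: "'a list \<Rightarrow> 'a set list \<Rightarrow> int mat" where
  "incidence_mat xs es =
     mat (length xs) (length es) (\<lambda>(i, j). if xs ! i \<in> es ! j then 1 else 0)"

definition integer_lattice :: "nat \<Rightarrow> real vec set" where
  "integer_lattice n = {v \<in> carrier_vec n. \<forall>i<n. v $ i \<in> \<int>}"

definition primal_feasible :: "real mat \<Rightarrow> real vec \<Rightarrow> bool" where
  "primal_feasible A x \<longleftrightarrow>
     x \<in> carrier_vec (dim_row A) \<and> 0\<^sub>v (dim_row A) \<le> x \<and>
     vec (dim_col A) (\<lambda>_. 1) \<le> transpose_mat A *\<^sub>v x"

definition dual_feasible :: "real mat \<Rightarrow> real vec \<Rightarrow> real vec \<Rightarrow> bool" where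
  "dual_feasible A \<alpha> y \<longleftrightarrow>
     y \<in> carrier_vec (dim_col A) \<and> 0\<^sub>v (dim_col A) \<le> y \<and> A *\<^sub>v y \<le> \<alpha>"

(* Optimality is over all real feasible vectors. Equality of the two optimal
   values is linear programming duality, hence not part of the definition. *)
definition max_flow_min_cut :: "real mat \<Rightarrow> bool" where
  "max_flow_min_cut A \<longleftrightarrow>
     (\<forall>\<alpha> \<in> integer_lattice (dim_row A). 0\<^sub>v (dim_row A) \<le> \<alpha> \<longrightarrow>
        (\<exists>x \<in> integer_lattice (dim_row A).
           is_arg_min (\<lambda>x. \<alpha> \<bullet> x) (primal_feasible A) x) \<and>
        (\<exists>y \<in> integer_lattice (dim_col A).
           is_arg_max (\<lambda>y. y \<bullet> vec (dim_col A) (\<lambda>_. 1)) (dual_feasible A \<alpha>) y))"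

definition rank_mat :: "int mat \<Rightarrow> nat" where
  "rank_mat A = vec_space.rank (dim_row A) (map_mat real_of_int A)"

definition subdet_gcd :: "nat \<Rightarrow> int mat \<Rightarrow> int" where
  "subdet_gcd r A =
     Gcd {det (submatrix A I J) | I J.
       I \<subseteq> {..<dim_row A} \<and> J \<subseteq> {..<dim_col A} \<and> card I = r \<and> card J = r \<and>
       det (submatrix A I J) \<noteq> 0}"

(* The next two notions are meant for finite S: over an infinite index set,
   finsum_vec is the zero vector. *)
definition nat_semigroup :: "nat \<Rightarrow> real vec set \<Rightarrow> real vec set" where
  "nat_semigroup n S =
     {finsum_vec TYPE(real) n (\<lambda>v. real (c v) \<cdot>\<^sub>v v) S | c :: real vec \<Rightarrow> nat. True}"

definition real_cone :: "nat \<Rightarrow> real vec set \<Rightarrow> real vec set" where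
  "real_cone n S =
     {finsum_vec TYPE(real) n (\<lambda>v. c v \<cdot>\<^sub>v v) S | c :: real vec \<Rightarrow> real. \<forall>v\<in>S. c v \<ge> 0}"

end

theory Submission
  imports Defs
begin

text \<open>
  Part (b): let \<open>a = A c\<close> be integral with \<open>c \<ge> 0\<close>, and let every edge have \<open>d\<close> vertices.
  For the capacity vector \<open>\<alpha> = a\<close>, summing coordinates shows that a dual feasible \<open>y\<close> has value
  at most \<open>\<bar>a\<bar> / d\<close>, with equality iff \<open>A y = a\<close>. Since \<open>c\<close> attains this bound, so does an
  integral optimal \<open>y\<close>, and hence \<open>a\<close> lies in the semigroup.

  Part (a): adding a large multiple of the sum of all columns, (b) implies that the lattice spanned by
  the columns is saturated. Suppose that a prime \<open>p\<close> divides all minors of order \<open>r\<close>, and take \<open>k < r\<close>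
  maximal with a minor \<open>m\<close> of order \<open>k\<close> not divisible by \<open>p\<close>. Bordering \<open>m\<close> by row \<open>i\<close> and column \<open>j\<close>
  gives numbers \<open>D i j\<close>, all divisible by \<open>p\<close>. The vector \<open>D _ j\<close> is congruent to \<open>m\<close> times column \<open>j\<close>
  modulo the columns of \<open>m\<close>, so by saturation \<open>D _ j / p\<close> is an integer combination of the columns.
  Applying the functional that borders \<open>m\<close> by row \<open>i\<close> improves \<open>p ^ e dvd D\<close> to \<open>p ^ (e + 1) dvd D\<close>.
  Hence \<open>D = 0\<close>, so the rank is at most \<open>k\<close>, a contradiction.
\<close>

section \<open>Minors indexed by row and column functions\<close>

text \<open>Rows and columns are chosen by functions, so that bordering a minor is the update
  \<open>f(k := i)\<close>; repeated indices are allowed and give 0.\<close>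

definition minor :: "'a :: comm_ring_1 mat \<Rightarrow> nat \<Rightarrow> (nat \<Rightarrow> nat) \<Rightarrow> (nat \<Rightarrow> nat) \<Rightarrow> 'a" where
  "minor A k f g = det (mat k k (\<lambda>(s, t). A $$ (f s, g t)))"

lemma minor_0 [simp]: "minor A 0 f g = 1"
  by (simp add: minor_def)

lemma minor_transpose:
  assumes "\<And>s. s < k \<Longrightarrow> f s < dim_row A" "\<And>t. t < k \<Longrightarrow> g t < dim_col A"
  shows "minor (transpose_mat A) k g f = minor A k f g"
proof -
  have "mat k k (\<lambda>(s, t). transpose_mat A $$ (g s, f t)) =
      transpose_mat (mat k k (\<lambda>(s, t). A $$ (f s, g t)))"
    using assms by (intro eq_matI) auto
  then show ?thesis
    unfolding minor_def by (metis det_transpose mat_carrier)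
qed

lemma minor_row_eq_0:
  assumes "s < k" "s' < k" "s \<noteq> s'" "f s = f s'"
  shows "minor A k f g = 0"
  unfolding minor_def
  by (rule det_identical_rows[OF _ assms(3,1,2)]) (use assms in \<open>auto simp: Matrix.row_def\<close>)

lemma minor_col_eq_0:
  assumes "t < k" "t' < k" "t \<noteq> t'" "g t = g t'"
  shows "minor A k f g = 0"
  unfolding minor_def
  by (rule det_identical_columns[OF _ assms(3,1,2)]) (use assms in \<open>auto simp: Matrix.col_def\<close>)

text \<open>Laplace expansion along the last row, the only one that involves \<open>i\<close>. The
  cofactors delete that row, so one \<open>c\<close> serves all \<open>i\<close>, and the corner
  cofactor is the unbordered minor.\<close>

lemma minor_expand_last_row:
  "\<exists>c. \<forall>i. minor A (Suc k) (f(k := i)) g =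
     minor A k f g * A $$ (i, g k) + (\<Sum>t<k. A $$ (i, g t) * c t)"
proof -
  define M where "M i = mat (Suc k) (Suc k) (\<lambda>(s, t). A $$ ((f(k := i)) s, g t))" for i
  have M: "M i \<in> carrier_mat (Suc k) (Suc k)" for i
    by (simp add: M_def)
  have del: "mat_delete (M i) k t = mat_delete (M 0) k t" for i t
    unfolding mat_delete_def M_def by (intro eq_matI) auto
  have last: "cofactor (M i) k k = minor A k f g" for i
    unfolding cofactor_def minor_def
    by (simp, rule arg_cong[where f = det]) (auto simp: mat_delete_def M_def)
  have "minor A (Suc k) (f(k := i)) g =
      minor A k f g * A $$ (i, g k) + (\<Sum>t<k. A $$ (i, g t) * cofactor (M 0) k t)" for i
  proof -
    have "minor A (Suc k) (f(k := i)) g = det (M i)"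
      by (simp add: minor_def M_def)
    also have "\<dots> = (\<Sum>t<Suc k. M i $$ (k, t) * cofactor (M i) k t)"
      by (rule laplace_expansion_row[OF M]) simp
    also have "\<dots> = (\<Sum>t<k. M i $$ (k, t) * cofactor (M i) k t) + M i $$ (k, k) * minor A k f g"
      by (simp add: last)
    also have "(\<Sum>t<k. M i $$ (k, t) * cofactor (M i) k t) =
        (\<Sum>t<k. A $$ (i, g t) * cofactor (M 0) k t)"
      by (intro sum.cong refl arg_cong2[where f = times]) (simp add: M_def, simp only: cofactor_def del[of i])
    also have "M i $$ (k, k) = A $$ (i, g k)"
      by (simp add: M_def)
    finally show ?thesis
      by (simp only: ac_simps)
  qed
  then show ?thesis
    by (intro exI allI)
qed

text \<open>The cofactors of the last column are independent of \<open>j\<close>, so bordering is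
  one fixed linear functional evaluated on column \<open>j\<close>.\<close>

lemma minor_expand_last_col:
  "\<exists>c. \<forall>j. minor A (Suc k) f (g(k := j)) = (\<Sum>s<Suc k. c s * A $$ (f s, j))"
proof -
  define M where "M j = mat (Suc k) (Suc k) (\<lambda>(s, t). A $$ (f s, (g(k := j)) t))" for j
  have M: "M j \<in> carrier_mat (Suc k) (Suc k)" for j
    by (simp add: M_def)
  have del: "mat_delete (M j) s k = mat_delete (M 0) s k" for j s
    unfolding mat_delete_def M_def by (intro eq_matI) auto
  have "minor A (Suc k) f (g(k := j)) = (\<Sum>s<Suc k. cofactor (M 0) s k * A $$ (f s, j))" for j
  proof -
    have "minor A (Suc k) f (g(k := j)) = det (M j)"
      by (simp add: minor_def M_def)
    also have "\<dots> = (\<Sum>s<Suc k. M j $$ (s, k) * cofactor (M j) s k)"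
      by (rule laplace_expansion_column[OF M]) simp
    also have "\<dots> = (\<Sum>s<Suc k. cofactor (M 0) s k * A $$ (f s, j))"
      by (intro sum.cong refl, subst mult.commute, intro arg_cong2[where f = times])
        (simp only: cofactor_def del[of j], simp add: M_def)
    finally show ?thesis .
  qed
  then show ?thesis
    by (intro exI allI)
qed

lemma inj_on_lessThan_eq_pick_permutes:
  fixes f :: "nat \<Rightarrow> nat"
  assumes inj: "inj_on f {..<r}"
  obtains \<pi> where "\<pi> permutes {0..<r}" "\<And>s. s < r \<Longrightarrow> f s = pick (f ` {..<r}) (\<pi> s)"
proof -
  let ?I = "f ` {..<r}"
  \<comment> \<open>\<open>pick\<close> lists the image in increasing order, so the position of
    \<open>f s\<close> is the number of smaller elements; beyond \<open>r\<close>,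
    \<open>permutes\<close> demands the identity.\<close>
  define \<pi> where "\<pi> s = (if s < r then card {a \<in> ?I. a < f s} else s)" for s
  have eq: "f s = pick ?I (\<pi> s)" if "s < r" for s
    using that pick_card_in_set[of "f s" ?I] by (simp add: \<pi>_def)
  have "\<pi> s < r" if "s < r" for s
  proof -
    have "card {a \<in> ?I. a < f s} < card ?I"
      using that by (intro psubset_card_mono) auto
    then show ?thesis
      using that card_image[OF inj] by (simp add: \<pi>_def)
  qed
  then have sub: "\<pi> ` {0..<r} \<subseteq> {0..<r}"
    by auto
  have "inj_on \<pi> {0..<r}"
  proof (rule inj_onI)
    fix s s' assume "s \<in> {0..<r}" "s' \<in> {0..<r}" "\<pi> s = \<pi> s'"
    then show "s = s'"
      using eq[of s] eq[of s'] inj_onD[OF inj, of s s'] by simp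
  qed
  then have "bij_betw \<pi> {0..<r} {0..<r}"
    using sub endo_inj_surj[of "{0..<r}" \<pi>] by (simp add: bij_betw_def)
  then have "\<pi> permutes {0..<r}"
    by (rule bij_imp_permutes) (simp add: \<pi>_def)
  then show thesis
    using eq that by blast
qed

lemma minor_permute_rows:
  assumes B: "B \<in> carrier_mat r nc" and \<pi>: "\<pi> permutes {0..<r}" and g: "\<And>t. t < r \<Longrightarrow> g t < nc"
  shows "minor B r \<pi> g = signof \<pi> * minor B r id g"
proof -
  have "\<pi> s < r" if "s < r" for s
    using permutes_in_image[OF \<pi>, of s] that by simp
  then have "mat r r (\<lambda>(s, t). B $$ (\<pi> s, g t)) =
      mat r r (\<lambda>(s, t). mat r r (\<lambda>(s, t). B $$ (s, g t)) $$ (\<pi> s, t))"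
    by (intro eq_matI) auto
  then show ?thesis
    unfolding minor_def
    using det_permute_rows[OF _ \<pi>, of "mat r r (\<lambda>(s, t). B $$ (s, g t))"] by simp
qed

text \<open>\<open>submatrix\<close> keeps rows and columns in increasing order, so for injective
  \<open>f\<close> and \<open>g\<close> the minor is a subdeterminant up to sign; columns are sorted
  by transposing. Otherwise two rows or two columns agree and the minor is 0.\<close>

lemma dvd_minor_if_dvd_submatrix:
  fixes A :: "'a :: comm_ring_1 mat"
  assumes dvd: "\<And>I J. \<lbrakk>I \<subseteq> {..<dim_row A}; J \<subseteq> {..<dim_col A}; card I = r; card J = r\<rbrakk>
      \<Longrightarrow> p dvd det (submatrix A I J)"
    and f: "\<And>s. s < r \<Longrightarrow> f s < dim_row A" and g: "\<And>t. t < r \<Longrightarrow> g t < dim_col A"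
  shows "p dvd minor A r f g"
proof (cases "inj_on f {..<r} \<and> inj_on g {..<r}")
  case True
  define I J where "I = f ` {..<r}" and "J = g ` {..<r}"
  obtain \<pi> where \<pi>: "\<pi> permutes {0..<r}" "\<And>s. s < r \<Longrightarrow> f s = pick I (\<pi> s)"
    using True inj_on_lessThan_eq_pick_permutes unfolding I_def by blast
  obtain \<sigma> where \<sigma>: "\<sigma> permutes {0..<r}" "\<And>t. t < r \<Longrightarrow> g t = pick J (\<sigma> t)"
    using True inj_on_lessThan_eq_pick_permutes unfolding J_def by blast
  have IJ: "I \<subseteq> {..<dim_row A}" "J \<subseteq> {..<dim_col A}" "card I = r" "card J = r"
    using True f g by (auto simp: I_def J_def card_image)
  then have I': "{i. i < dim_row A \<and> i \<in> I} = I" and J': "{j. j < dim_col A \<and> j \<in> J} = J"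
    by auto
  define B where "B = submatrix A I J"
  have B: "B \<in> carrier_mat r r"
    using dim_submatrix[of A I J] IJ by (auto simp: B_def I' J')
  have \<pi>r: "\<pi> s < r" and \<sigma>r: "\<sigma> s < r" if "s < r" for s
    using permutes_in_image[OF \<pi>(1), of s] permutes_in_image[OF \<sigma>(1), of s] that by simp_all
  have "minor A r f g = minor B r \<pi> \<sigma>"
    unfolding minor_def
    by (rule arg_cong[where f = det], rule eq_matI)
      (use \<pi>(2) \<sigma>(2) \<pi>r \<sigma>r IJ in \<open>simp_all add: B_def submatrix_index I' J'\<close>)
  also have "\<dots> = signof \<pi> * minor B r id \<sigma>"
    using minor_permute_rows[OF B \<pi>(1)] \<sigma>r by blast
  also have "minor B r id \<sigma> = minor (transpose_mat B) r \<sigma> id"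
    using minor_transpose[of r id B \<sigma>] B \<sigma>r by simp
  also have "\<dots> = signof \<sigma> * minor (transpose_mat B) r id id"
    by (rule minor_permute_rows[OF _ \<sigma>(1)]) (use B in auto)
  also have "minor (transpose_mat B) r id id = minor B r id id"
    using minor_transpose[of r id B id] B by simp
  also have "\<dots> = det B"
    unfolding minor_def by (rule arg_cong[where f = det], rule eq_matI) (use B in auto)
  finally show ?thesis
    using dvd[OF IJ] by (simp add: B_def)
next
  case False
  then show ?thesis
    by (auto simp: inj_on_def minor_row_eq_0 minor_col_eq_0)
qed

section \<open>Column spans and the rank\<close>

lemma (in vec_space) linear_combination_in_span:
  assumes "finite F" "T \<subseteq> carrier_vec n" "\<And>t. t \<in> F \<Longrightarrow> v t \<in> T"
  shows "vec n (\<lambda>i. \<Sum>t\<in>F. d t * v t $ i) \<in> span T"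
  using assms(1,3)
proof (induction F)
  case empty
  have "vec n (\<lambda>i. 0) = (0\<^sub>v n :: 'a vec)"
    by (intro eq_vecI) auto
  then show ?case
    using vectorspace.span_zero[OF vectorspace_axioms, of T] by (simp add: module_vec_simps)
next
  case (insert x F)
  have "v x \<in> carrier_vec n"
    using insert.prems assms(2) by auto
  then have "vec n (\<lambda>i. \<Sum>t\<in>insert x F. d t * v t $ i) =
      d x \<cdot>\<^sub>v v x + vec n (\<lambda>i. \<Sum>t\<in>F. d t * v t $ i)"
    using insert assms(2) by (intro eq_vecI) auto
  moreover have "d x \<cdot>\<^sub>v v x \<in> span T"
    using insert.prems assms(2) by (intro smult_in_span span_mem) auto
  ultimately show ?case
    using insert.IH insert.prems span_add1[OF assms(2)] by (simp add: module_vec_simps)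
qed

text \<open>The columns and \<open>T\<close> have the same span, whose dimension is the size of a
  maximal independent subset of \<open>T\<close>.\<close>

lemma (in vec_space) rank_le_card_if_cols_in_span:
  assumes A: "A \<in> carrier_mat n nc" and T: "T \<subseteq> set (cols A)" and sub: "set (cols A) \<subseteq> span T"
  shows "rank A \<le> card T"
proof -
  have cT: "T \<subseteq> carrier_vec n" "finite T"
    using A T cols_dim[of A] finite_subset by auto
  have "lin_indpt {}"
    by (simp add: finite_lin_indpt2)
  then obtain U where U: "maximal U (\<lambda>S. S \<subseteq> T \<and> lin_indpt S)"
    using maximal_exists_superset[OF cT(2), of "\<lambda>S. S \<subseteq> T \<and> lin_indpt S" "{}"] by auto
  have "span (set (cols A)) = span T"
    using sub span_is_monotone[OF T] span_is_subset[OF sub span_is_submodule[OF cT(1)]] by blast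
  then have "rank A = card U"
    using dim_span[of T U] cT U by (simp add: rank_def)
  also have "\<dots> \<le> card T"
    using U cT by (auto simp: maximal_def intro: card_mono)
  finally show ?thesis .
qed


section \<open>Saturation and the gcd of the minors of maximal order\<close>

text \<open>Equivalently, the quotient of the integer lattice by the lattice of the columns is
  torsion-free.\<close>

definition saturated_columns :: "int mat \<Rightarrow> bool" where
  "saturated_columns A \<longleftrightarrow>
     (\<forall>u c. (\<forall>i<dim_row A. real_of_int (u i) = (\<Sum>j<dim_col A. real_of_int (A $$ (i, j)) * c j)) \<longrightarrow>
        (\<exists>z. \<forall>i<dim_row A. u i = (\<Sum>j<dim_col A. A $$ (i, j) * z j)))"

lemma saturated_columnsD:
  assumes "saturated_columns A" "A \<in> carrier_mat n q"
    and "\<And>i. i < n \<Longrightarrow> real_of_int (u i) = (\<Sum>j<q. real_of_int (A $$ (i, j)) * c j)"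
  shows "\<exists>z. \<forall>i<n. u i = (\<Sum>j<q. A $$ (i, j) * z j)"
  using assms(1,3) carrier_matD[OF assms(2)] unfolding saturated_columns_def by blast

text \<open>Bordered minors, one prime at a time, take the place of the Smith normal form.\<close>

lemma not_prime_dvd_minor_rank_if_saturated:
  fixes A :: "int mat"
  assumes A: "A \<in> carrier_mat n q" and p: "prime p"
    and saturated: "saturated_columns A"
  shows "\<exists>f g. (\<forall>s<rank_mat A. f s < n \<and> g s < q) \<and> \<not> p dvd minor A (rank_mat A) f g"
proof (rule ccontr)
  let ?r = "rank_mat A"
  define P where "P k \<longleftrightarrow> (\<exists>f g. (\<forall>s<k. f s < n \<and> g s < q) \<and> \<not> p dvd minor A k f g)" for k
  assume "\<not> ?thesis"
  then have "\<not> P ?r"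
    unfolding P_def by blast
  moreover have "P 0"
    using p by (auto simp: P_def not_prime_unit)
  \<comment> \<open>\<open>P\<close> holds at 0, where the empty minor is 1, and fails at the rank,
    so it breaks at some step from \<open>k\<close> to \<open>Suc k\<close>.\<close>
  ultimately obtain k where k: "k < ?r" "P k" "\<not> P (Suc k)"
    using dec_induct[of 0 ?r P] by blast
  then obtain f g where fg: "\<And>s. s < k \<Longrightarrow> f s < n" "\<And>s. s < k \<Longrightarrow> g s < q"
    and m_dvd: "\<not> p dvd minor A k f g"
    unfolding P_def by blast
  define m where "m = minor A k f g"
  define D where "D i j = minor A (Suc k) (f(k := i)) (g(k := j))" for i j
  have f_upd: "(f(k := i)) s < n" if "i < n" "s < Suc k" for i s
    using that fg by (auto simp: less_Suc_eq)
  have g_upd: "(g(k := j)) s < q" if "j < q" "s < Suc k" for j s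
    using that fg by (auto simp: less_Suc_eq)
  have p_dvd_D: "p dvd D i j" if "i < n" "j < q" for i j
    using k(3) f_upd[OF that(1)] g_upd[OF that(2)] unfolding P_def D_def by blast
  have D_g: "D i (g t) = 0" if "t < k" for i t
    unfolding D_def by (rule minor_col_eq_0[of t _ k]) (use that in auto)
  have "\<exists>c. \<forall>i. D i j = m * A $$ (i, j) + (\<Sum>t<k. A $$ (i, g t) * c t)" for j
  proof -
    have "minor A k f (g(k := j)) = m"
      unfolding m_def minor_def by (rule arg_cong[where f = det]) auto
    then show ?thesis
      using minor_expand_last_row[of A k f "g(k := j)"] by (simp add: D_def)
  qed
  then obtain c where row: "\<And>i j. D i j = m * A $$ (i, j) + (\<Sum>t<k. A $$ (i, g t) * c j t)"
    by metis
  \<comment> \<open>\<open>h i\<close> is the functional that borders by row \<open>i\<close>: its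
    value on column \<open>j\<close> is \<open>D i j\<close>, so by \<open>D_g\<close> it vanishes
    on the columns \<open>g t\<close>.\<close>
  have "\<exists>h. \<forall>j. D i j = (\<Sum>s<Suc k. h s * A $$ ((f(k := i)) s, j))" for i
    unfolding D_def by (rule minor_expand_last_col)
  then obtain h where col: "\<And>i j. D i j = (\<Sum>s<Suc k. h i s * A $$ ((f(k := i)) s, j))"
    by metis
  have quot: "\<exists>z. \<forall>i<n. D i j div p = (\<Sum>l<q. A $$ (i, l) * z l)" if j: "j < q" for j
  proof -
    \<comment> \<open>\<open>b\<close> writes \<open>D _ j\<close> as an integer combination of all
      columns; the indicators add up coefficients of coinciding indices. Dividing by
      \<open>p\<close> leaves real coefficients but, by \<open>p_dvd_D\<close>, integral entries, so
      saturation applies.\<close>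
    define b where "b l = (if l = j then m else 0) + (\<Sum>t<k. if l = g t then c j t else 0)" for l
    have b: "D i j = (\<Sum>l<q. A $$ (i, l) * b l)" for i
    proof -
      have "(\<Sum>l<q. A $$ (i, l) * b l) = (\<Sum>l<q. if l = j then A $$ (i, l) * m else 0) +
          (\<Sum>l<q. \<Sum>t<k. if l = g t then A $$ (i, l) * c j t else 0)"
        unfolding sum.distrib[symmetric]
        by (intro sum.cong) (simp_all add: b_def distrib_left sum_distrib_left if_distrib[of "times _"] cong: if_cong)
      also have "(\<Sum>l<q. \<Sum>t<k. if l = g t then A $$ (i, l) * c j t else 0) =
          (\<Sum>t<k. \<Sum>l<q. if l = g t then A $$ (i, l) * c j t else 0)"
        by (rule sum.swap)
      also have "\<dots> = (\<Sum>t<k. A $$ (i, g t) * c j t)"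
        using fg(2) by (intro sum.cong) auto
      finally show ?thesis
        using j by (simp add: row)
    qed
    show ?thesis
    proof (rule saturated_columnsD[OF saturated A, where c = "\<lambda>l. real_of_int (b l) / real_of_int p"])
      fix i assume "i < n"
      then have "real_of_int (D i j div p) = real_of_int (D i j) / real_of_int p"
        using p_dvd_D j by (intro real_of_int_div) auto
      then show "real_of_int (D i j div p) =
          (\<Sum>l<q. real_of_int (A $$ (i, l)) * (real_of_int (b l) / real_of_int p))"
        by (simp add: b sum_divide_distrib)
    qed
  qed
  have coprime: "coprime (p ^ e) m" for e
    using p m_dvd by (simp add: m_def prime_imp_coprime)
  have pow_dvd: "p ^ e dvd D i j" if "i < n" "j < q" for e i j
    using that
  proof (induction e arbitrary: i j)
    case (Suc e)
    obtain z where z: "\<And>i. i < n \<Longrightarrow> D i j div p = (\<Sum>l<q. A $$ (i, l) * z l)"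
      using quot[OF Suc.prems(2)] by blast
    let ?F = "\<lambda>s. (f(k := i)) s"
    \<comment> \<open>evaluate the bordering functional of row \<open>i\<close> on \<open>D _ j = m * A _ j + \<dots>\<close>; it vanishes on the columns \<open>g t\<close>\<close>
    have "p * (\<Sum>l<q. z l * D i l) = (\<Sum>l<q. \<Sum>s<Suc k. h i s * (p * (A $$ (?F s, l) * z l)))"
      unfolding col by (simp only: sum_distrib_left ac_simps)
    also have "\<dots> = (\<Sum>s<Suc k. \<Sum>l<q. h i s * (p * (A $$ (?F s, l) * z l)))"
      by (rule sum.swap)
    also have "\<dots> = (\<Sum>s<Suc k. h i s * D (?F s) j)"
    proof (rule sum.cong[OF refl])
      fix s assume "s \<in> {..<Suc k}"
      then have "?F s < n"
        using f_upd Suc.prems(1) by simp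
      then have "D (?F s) j = p * (\<Sum>l<q. A $$ (?F s, l) * z l)"
        using z[of "?F s"] p_dvd_D[of "?F s" j] Suc.prems(2) by (metis dvd_mult_div_cancel)
      then show "(\<Sum>l<q. h i s * (p * (A $$ (?F s, l) * z l))) = h i s * D (?F s) j"
        by (simp only: sum_distrib_left)
    qed
    also have "\<dots> = (\<Sum>s<Suc k. h i s * (m * A $$ (?F s, j))) +
        (\<Sum>s<Suc k. \<Sum>t<k. h i s * (A $$ (?F s, g t) * c j t))"
      by (simp only: row distrib_left sum.distrib sum_distrib_left)
    also have "(\<Sum>s<Suc k. \<Sum>t<k. h i s * (A $$ (?F s, g t) * c j t)) =
        (\<Sum>t<k. \<Sum>s<Suc k. h i s * (A $$ (?F s, g t) * c j t))"
      by (rule sum.swap)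
    also have "\<dots> = (\<Sum>t<k. c j t * D i (g t))"
      unfolding col by (simp only: sum_distrib_left ac_simps)
    also have "\<dots> = 0"
      by (simp add: D_g)
    also have "(\<Sum>s<Suc k. h i s * (m * A $$ (?F s, j))) = m * D i j"
      unfolding col by (simp only: sum_distrib_left ac_simps)
    finally have eq: "p * (\<Sum>l<q. z l * D i l) = m * D i j"
      by simp
    \<comment> \<open>The induction hypothesis is applied to every column in row \<open>i\<close>;
      the factor \<open>p\<close> in \<open>eq\<close> supplies the extra power, and
      \<open>m\<close> cancels by coprimality.\<close>
    have "p ^ e dvd (\<Sum>l<q. z l * D i l)"
      using Suc.IH Suc.prems by (intro dvd_sum dvd_mult) auto
    then have "p ^ Suc e dvd m * D i j"
      unfolding eq[symmetric] by (simp add: mult_dvd_mono)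
    then show ?case
      using coprime coprime_dvd_mult_right_iff by blast
  qed simp
  have D_0: "D i j = 0" if "i < n" "j < q" for i j
  proof (rule ccontr)
    assume "D i j \<noteq> 0"
    \<comment> \<open>This exponent suffices: a nonzero \<open>D i j\<close> would give
      \<open>e < 2 ^ e \<le> p ^ e \<le> \<bar>D i j\<bar> = e\<close>.\<close>
    define e where "e = nat \<bar>D i j\<bar>"
    have "p ^ e \<le> \<bar>D i j\<bar>"
      using \<open>D i j \<noteq> 0\<close> pow_dvd[OF that, of e]
      by (meson dvd_abs_iff dvd_imp_le_int zdvd_imp_le zero_less_abs_iff)
    moreover have "int e < 2 ^ e"
      by (metis of_nat_less_two_power)
    moreover have "(2::int) ^ e \<le> p ^ e"
      using prime_ge_2_int[OF p] by (intro power_mono) auto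
    ultimately show False
      by (simp add: e_def)
  qed
  define R where "R = map_mat real_of_int A"
  interpret vec_space "TYPE(real)" n .
  have R: "R \<in> carrier_mat n q"
    using A by (simp add: R_def)
  define T where "T = (\<lambda>t. Matrix.col R (g t)) ` {..<k}"
  have "set (cols R) = Matrix.col R ` {..<q}"
    using R by (auto simp: cols_def)
  then have T: "T \<subseteq> set (cols R)"
    using fg(2) by (auto simp: T_def)
  have m_0: "m \<noteq> 0"
    using m_dvd by (auto simp: m_def)
  have "Matrix.col R j \<in> span T" if j: "j < q" for j
  proof -
    \<comment> \<open>As \<open>D\<close> vanishes and \<open>m\<close> does not, \<open>row\<close>
      can be solved for column \<open>j\<close> over the reals.\<close>
    have "Matrix.col R j = vec n (\<lambda>i. \<Sum>t<k. (- real_of_int (c j t) / real_of_int m) * Matrix.col R (g t) $ i)"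
    proof (rule eq_vecI)
      fix i assume "i < dim_vec (vec n (\<lambda>i. \<Sum>t<k. (- real_of_int (c j t) / real_of_int m) * Matrix.col R (g t) $ i))"
      then have i: "i < n" by simp
      have "m * A $$ (i, j) = - (\<Sum>t<k. A $$ (i, g t) * c j t)"
        using row[of i j] D_0[OF i j] by linarith
      then have "real_of_int m * R $$ (i, j) = - (\<Sum>t<k. R $$ (i, g t) * real_of_int (c j t))"
        using A i j fg(2) by (simp add: R_def flip: of_int_mult of_int_sum of_int_minus)
      then have "R $$ (i, j) = - (\<Sum>t<k. R $$ (i, g t) * real_of_int (c j t)) / real_of_int m"
        using m_0 by (simp add: field_simps)
      then show "Matrix.col R j $ i =
          vec n (\<lambda>i. \<Sum>t<k. (- real_of_int (c j t) / real_of_int m) * Matrix.col R (g t) $ i) $ i"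
        using R i j fg(2) by (simp add: sum_divide_distrib sum_negf mult.commute)
    qed (use R in simp)
    also have "\<dots> \<in> span T"
      by (rule linear_combination_in_span) (use R in \<open>auto simp: T_def\<close>)
    finally show ?thesis .
  qed
  then have "rank R \<le> card T"
    using rank_le_card_if_cols_in_span[OF R T] \<open>set (cols R) = _\<close> by auto
  also have "\<dots> \<le> k"
    unfolding T_def using card_image_le[of "{..<k}"] by simp
  finally show False
    using k(1) A by (simp add: rank_mat_def R_def)
qed

lemma subdet_gcd_rank_eq_1_if_saturated:
  fixes A :: "int mat"
  assumes A: "A \<in> carrier_mat n q"
    and saturated: "saturated_columns A"
  shows "subdet_gcd (rank_mat A) A = 1"
proof (rule ccontr)
  let ?r = "rank_mat A" and ?G = "subdet_gcd (rank_mat A) A"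
  assume "?G \<noteq> 1"
  moreover have "?G \<ge> 0"
    by (simp add: subdet_gcd_def)
  ultimately have "\<not> is_unit ?G"
    by auto
  then obtain p where p: "prime p" "p dvd ?G"
    proof (cases "?G = 0")
    \<comment> \<open>If no subdeterminant of this order is nonzero, the gcd of the empty set is 0;
      the prime 2 divides it, so the same contradiction covers this case.\<close>
    case True
    have "prime (2 :: int)"
      by simp
    with True that show thesis
      by (metis dvd_0_right)
  qed (use prime_divisor_exists[of ?G] that in blast)
  have "p dvd det (submatrix A I J)"
    if "I \<subseteq> {..<dim_row A}" "J \<subseteq> {..<dim_col A}" "card I = ?r" "card J = ?r" for I J
  proof (cases "det (submatrix A I J) = 0")
    case False
    then have "?G dvd det (submatrix A I J)"
      unfolding subdet_gcd_def by (intro Gcd_dvd) (use that in blast)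
    then show ?thesis
      using p(2) dvd_trans by blast
  qed simp
  then have "p dvd minor A ?r f g" if "\<forall>s<?r. f s < n \<and> g s < q" for f g
    using that A by (intro dvd_minor_if_dvd_submatrix) auto
  then show False
    using not_prime_dvd_minor_rank_if_saturated[OF A p(1) saturated] by blast
qed

section \<open>Integral optimal solutions of the dual program\<close>

text \<open>The entrywise form of (b), for nonnegative matrices with constant column sums; it yields
  both the semigroup equality and saturation.\<close>

lemma max_flow_min_cut_nat_coefficients:
  fixes A :: "int mat"
  assumes A: "A \<in> carrier_mat n q"
    and nonneg: "\<And>i j. \<lbrakk>i < n; j < q\<rbrakk> \<Longrightarrow> A $$ (i, j) \<ge> 0"
    and col_sum: "\<And>j. j < q \<Longrightarrow> (\<Sum>i<n. A $$ (i, j)) = d" and d: "d > 0"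
    and mfmc: "max_flow_min_cut (map_mat real_of_int A)"
    and c: "\<And>j. j < q \<Longrightarrow> c j \<ge> 0"
    and u: "\<And>i. i < n \<Longrightarrow> real_of_int (u i) = (\<Sum>j<q. real_of_int (A $$ (i, j)) * c j)"
  shows "\<exists>y. \<forall>i<n. u i = (\<Sum>j<q. A $$ (i, j) * int (y j))"
proof -
  define R where "R = map_mat real_of_int A"
  have R: "R \<in> carrier_mat n q"
    using A by (simp add: R_def)
  have R_idx: "R $$ (i, j) = real_of_int (A $$ (i, j))" if "i < n" "j < q" for i j
    using A that by (simp add: R_def)
  define \<alpha> where "\<alpha> = vec n (\<lambda>i. real_of_int (u i))"
  have mult: "(R *\<^sub>v y) $ i = (\<Sum>j<q. real_of_int (A $$ (i, j)) * y $ j)"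
    if "i < n" "y \<in> carrier_vec q" for y i
    using R that by (auto simp: scalar_prod_def R_idx lessThan_atLeast0 intro!: sum.cong)
  have objective: "y \<bullet> vec q (\<lambda>_. 1) = (\<Sum>j<q. y $ j)" for y :: "real vec"
    by (simp add: scalar_prod_def lessThan_atLeast0)
  have "\<alpha> \<in> integer_lattice n"
    by (simp add: \<alpha>_def integer_lattice_def)
  moreover have "0\<^sub>v n \<le> \<alpha>"
    using nonneg c by (auto simp: \<alpha>_def less_eq_vec_def u intro!: sum_nonneg)
  ultimately obtain y where y: "y \<in> integer_lattice q"
    and opt: "is_arg_max (\<lambda>y. y \<bullet> vec q (\<lambda>_. 1)) (dual_feasible R \<alpha>) y"
    using mfmc R unfolding max_flow_min_cut_def R_def[symmetric] by auto
  have feas: "dual_feasible R \<alpha> y"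
    using opt by (simp add: is_arg_max_def)
  have yc: "y \<in> carrier_vec q" and "0\<^sub>v q \<le> y"
    using feas carrier_matD(2)[OF R] by (simp_all only: dual_feasible_def)
  then have y0: "y $ j \<ge> 0" if "j < q" for j
    using that unfolding less_eq_vec_def carrier_vecD[OF yc] by fastforce
  have yle: "(\<Sum>j<q. real_of_int (A $$ (i, j)) * y $ j) \<le> real_of_int (u i)" if "i < n" for i
  proof -
    have "R *\<^sub>v y \<le> \<alpha>"
      using feas by (simp add: dual_feasible_def)
    then have "(R *\<^sub>v y) $ i \<le> \<alpha> $ i"
      using that by (simp add: less_eq_vec_def \<alpha>_def del: index_mult_mat_vec)
    then show ?thesis
      unfolding mult[OF that yc] using that by (simp add: \<alpha>_def)
  qed
  \<comment> \<open>The given coefficients \<open>c\<close> meet the capacity with equality, so they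
    compete with the integral optimum \<open>y\<close>.\<close>
  have "R *\<^sub>v vec q c = \<alpha>"
  proof (rule eq_vecI)
    show "(R *\<^sub>v vec q c) $ i = \<alpha> $ i" if "i < dim_vec \<alpha>" for i
      using that mult[of i "vec q c"] by (simp add: \<alpha>_def u del: index_mult_mat_vec)
  qed (use R in \<open>simp add: \<alpha>_def\<close>)
  then have "dual_feasible R \<alpha> (vec q c)"
    using R c by (simp add: dual_feasible_def less_eq_vec_def)
  then have "\<not> y \<bullet> vec q (\<lambda>_. 1) < vec q c \<bullet> vec q (\<lambda>_. 1)"
    using opt by (auto simp: is_arg_max_def)
  then have le: "(\<Sum>j<q. c j) \<le> (\<Sum>j<q. y $ j)"
    by (simp add: objective)
  \<comment> \<open>\<open>?s i\<close> is the slack of \<open>y\<close> in row \<open>i\<close>.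
    The slacks are nonnegative, and their sum is \<open>d\<close> times a difference that optimality
    of \<open>y\<close> makes nonpositive, so all of them vanish.\<close>
  let ?s = "\<lambda>i. real_of_int (u i) - (\<Sum>j<q. real_of_int (A $$ (i, j)) * y $ j)"
  have total: "(\<Sum>i<n. \<Sum>j<q. real_of_int (A $$ (i, j)) * x j) = real_of_int d * (\<Sum>j<q. x j)" for x
  proof -
    have "(\<Sum>i<n. \<Sum>j<q. real_of_int (A $$ (i, j)) * x j) = (\<Sum>j<q. \<Sum>i<n. real_of_int (A $$ (i, j)) * x j)"
      by (rule sum.swap)
    also have "\<dots> = (\<Sum>j<q. real_of_int (\<Sum>i<n. A $$ (i, j)) * x j)"
      by (simp add: sum_distrib_right)
    also have "\<dots> = real_of_int d * (\<Sum>j<q. x j)"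
      by (simp add: col_sum sum_distrib_left)
    finally show ?thesis .
  qed
  have "(\<Sum>i<n. ?s i) = real_of_int d * ((\<Sum>j<q. c j) - (\<Sum>j<q. y $ j))"
    by (simp add: u sum_subtractf total right_diff_distrib)
  also have "\<dots> \<le> 0"
    using le d by (simp add: mult_nonneg_nonpos)
  finally have "(\<Sum>i<n. ?s i) = 0"
    using yle by (intro antisym sum_nonneg) auto
  then have s0: "?s i = 0" if "i < n" for i
    using that yle sum_nonneg_eq_0_iff[of "{..<n}" ?s] by auto
  \<comment> \<open>\<open>y\<close> is integral and nonnegative, so the floor and the conversion to
    \<open>nat\<close> lose nothing.\<close>
  have y_nat: "real (nat \<lfloor>y $ j\<rfloor>) = y $ j" if "j < q" for j
    using y y0 that by (auto simp: integer_lattice_def elim!: Ints_cases)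
  have "u i = (\<Sum>j<q. A $$ (i, j) * int (nat \<lfloor>y $ j\<rfloor>))" if "i < n" for i
  proof -
    have "real_of_int (u i) = (\<Sum>j<q. real_of_int (A $$ (i, j)) * real (nat \<lfloor>y $ j\<rfloor>))"
      using s0[OF that] by (simp add: y_nat)
    also have "\<dots> = real_of_int (\<Sum>j<q. A $$ (i, j) * int (nat \<lfloor>y $ j\<rfloor>))"
      by (simp only: of_int_sum of_int_mult of_int_of_nat_eq)
    finally show ?thesis
      by linarith
  qed
  then show ?thesis
    by (intro exI allI impI)
qed

lemma max_flow_min_cut_saturated:
  fixes A :: "int mat"
  assumes A: "A \<in> carrier_mat n q"
    and nonneg: "\<And>i j. \<lbrakk>i < n; j < q\<rbrakk> \<Longrightarrow> A $$ (i, j) \<ge> 0"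
    and col_sum: "\<And>j. j < q \<Longrightarrow> (\<Sum>i<n. A $$ (i, j)) = d" and d: "d > 0"
    and mfmc: "max_flow_min_cut (map_mat real_of_int A)"
  shows "saturated_columns A"
  unfolding saturated_columns_def
proof (intro allI impI)
  fix u :: "nat \<Rightarrow> int" and c
  assume "\<forall>i<dim_row A. real_of_int (u i) = (\<Sum>j<dim_col A. real_of_int (A $$ (i, j)) * c j)"
  then have u: "\<forall>i<n. real_of_int (u i) = (\<Sum>j<q. real_of_int (A $$ (i, j)) * c j)"
    using A by auto
  \<comment> \<open>The summands are nonnegative, so the integer \<open>K\<close> dominates every
    \<open>\<bar>c j\<bar>\<close>. It is added to all coefficients, which keeps the vector
    integral, and subtracted again at the end.\<close>
  define K where "K = (\<Sum>j<q. \<lceil>\<bar>c j\<bar>\<rceil>)"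
  have "c j + real_of_int K \<ge> 0" if "j < q" for j
  proof -
    have "\<lceil>\<bar>c j\<bar>\<rceil> \<le> K"
      unfolding K_def using that by (intro member_le_sum) auto
    then show ?thesis
      by linarith
  qed
  moreover have "real_of_int (u i + (\<Sum>j<q. A $$ (i, j) * K)) =
      (\<Sum>j<q. real_of_int (A $$ (i, j)) * (c j + real_of_int K))" if "i < n" for i
    using u that by (simp add: distrib_left sum.distrib)
  ultimately obtain y where "\<forall>i<n. u i + (\<Sum>j<q. A $$ (i, j) * K) = (\<Sum>j<q. A $$ (i, j) * int (y j))"
    using max_flow_min_cut_nat_coefficients[OF A nonneg col_sum d mfmc,
        where c = "\<lambda>j. c j + real_of_int K" and u = "\<lambda>i. u i + (\<Sum>j<q. A $$ (i, j) * K)"]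
    by blast
  then have "\<forall>i<n. u i = (\<Sum>j<q. A $$ (i, j) * (int (y j) - K))"
    by (simp add: right_diff_distrib sum_subtractf eq_diff_eq)
  then show "\<exists>z. \<forall>i<dim_row A. u i = (\<Sum>j<dim_col A. A $$ (i, j) * z j)"
    using A by (intro exI[of _ "\<lambda>j. int (y j) - K"]) auto
qed

section \<open>Semigroup and cone of the columns in coordinates\<close>

text \<open>A sum over the set of columns counts equal columns once; distinctness makes
  \<open>Matrix.col R\<close> injective and allows reindexing by column numbers.\<close>

lemma finsum_vec_cols:
  fixes R :: "real mat"
  assumes R: "R \<in> carrier_mat n q" and dist: "distinct (cols R)"
  shows "finsum_vec TYPE(real) n (\<lambda>v. h v \<cdot>\<^sub>v v) (set (cols R)) =
    vec n (\<lambda>i. \<Sum>j<q. R $$ (i, j) * h (Matrix.col R j))"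
proof (rule eq_vecI)
  let ?F = "\<lambda>v. h v \<cdot>\<^sub>v v"
  have F: "?F \<in> set (cols R) \<rightarrow> carrier_vec n"
    using R cols_dim[of R] by auto
  show "dim_vec (finsum_vec TYPE(real) n ?F (set (cols R))) =
      dim_vec (vec n (\<lambda>i. \<Sum>j<q. R $$ (i, j) * h (Matrix.col R j)))"
    using carrier_vecD[OF finsum_vec_closed[OF F]] by simp
  fix i assume "i < dim_vec (vec n (\<lambda>i. \<Sum>j<q. R $$ (i, j) * h (Matrix.col R j)))"
  then have i: "i < n" by simp
  have img: "set (cols R) = Matrix.col R ` {..<q}"
    using R by (auto simp: cols_def)
  have inj: "inj_on (Matrix.col R) {..<q}"
    using dist R by (auto simp: cols_def distinct_map lessThan_atLeast0)
  have "finsum_vec TYPE(real) n ?F (set (cols R)) $ i = (\<Sum>v\<in>set (cols R). ?F v $ i)"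
    by (rule index_finsum_vec[OF _ i F]) simp
  also have "\<dots> = (\<Sum>j<q. ?F (Matrix.col R j) $ i)"
    unfolding img by (simp add: sum.reindex[OF inj])
  also have "\<dots> = (\<Sum>j<q. R $$ (i, j) * h (Matrix.col R j))"
    using R i by (intro sum.cong) auto
  finally show "finsum_vec TYPE(real) n ?F (set (cols R)) $ i =
      vec n (\<lambda>i. \<Sum>j<q. R $$ (i, j) * h (Matrix.col R j)) $ i"
    using i by simp
qed

text \<open>The inverse of the injective map \<open>Matrix.col R\<close> carries coefficients from
  column numbers to column vectors.\<close>

lemma coefficients_on_cols:
  assumes R: "R \<in> carrier_mat n q" and dist: "distinct (cols R)"
  obtains h where "\<And>j. j < q \<Longrightarrow> h (Matrix.col R j) = c j"
proof
  have "inj_on (Matrix.col R) {..<q}"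
    using dist R by (auto simp: cols_def distinct_map lessThan_atLeast0)
  then show "c (the_inv_into {..<q} (Matrix.col R) (Matrix.col R j)) = c j" if "j < q" for j
    using that by (simp add: the_inv_into_f_f)
qed

lemma nat_semigroup_cols:
  assumes R: "R \<in> carrier_mat n q" and dist: "distinct (cols R)"
  shows "nat_semigroup n (set (cols R)) = {vec n (\<lambda>i. \<Sum>j<q. R $$ (i, j) * real (y j)) | y. True}"
proof -
  have "vec n (\<lambda>i. \<Sum>j<q. R $$ (i, j) * real (y j)) \<in> nat_semigroup n (set (cols R))" for y
  proof -
    obtain h where "\<And>j. j < q \<Longrightarrow> h (Matrix.col R j) = y j"
      using coefficients_on_cols[OF assms] by blast
    then have "vec n (\<lambda>i. \<Sum>j<q. R $$ (i, j) * real (y j)) =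
        finsum_vec TYPE(real) n (\<lambda>v. real (h v) \<cdot>\<^sub>v v) (set (cols R))"
      unfolding finsum_vec_cols[OF assms, of "\<lambda>v. real (h v)"] by (intro eq_vecI) auto
    then show ?thesis
      unfolding nat_semigroup_def by blast
  qed
  then show ?thesis
    by (auto simp: nat_semigroup_def finsum_vec_cols[OF assms, of "\<lambda>v. real (_ v)"])
qed

lemma real_cone_cols:
  assumes R: "R \<in> carrier_mat n q" and dist: "distinct (cols R)"
  shows "real_cone n (set (cols R)) =
    {vec n (\<lambda>i. \<Sum>j<q. R $$ (i, j) * c j) | c. \<forall>j<q. c j \<ge> 0}"
proof -
  have img: "set (cols R) = Matrix.col R ` {..<q}"
    using R by (auto simp: cols_def)
  have "vec n (\<lambda>i. \<Sum>j<q. R $$ (i, j) * c j) \<in> real_cone n (set (cols R))" if "\<forall>j<q. c j \<ge> 0" for c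
  proof -
    obtain h where h: "\<And>j. j < q \<Longrightarrow> h (Matrix.col R j) = c j"
      using coefficients_on_cols[OF assms] by blast
    then have "vec n (\<lambda>i. \<Sum>j<q. R $$ (i, j) * c j) =
        finsum_vec TYPE(real) n (\<lambda>v. h v \<cdot>\<^sub>v v) (set (cols R))"
      unfolding finsum_vec_cols[OF assms] by (intro eq_vecI) auto
    moreover have "\<forall>v\<in>set (cols R). h v \<ge> 0"
      using h that by (auto simp: img)
    ultimately show ?thesis
      unfolding real_cone_def by blast
  qed
  moreover have "\<exists>c. finsum_vec TYPE(real) n (\<lambda>v. h v \<cdot>\<^sub>v v) (set (cols R)) =
      vec n (\<lambda>i. \<Sum>j<q. R $$ (i, j) * c j) \<and> (\<forall>j<q. c j \<ge> 0)"
    if "\<forall>v\<in>set (cols R). h v \<ge> 0" for h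
    using that unfolding finsum_vec_cols[OF assms]
    by (intro exI[of _ "\<lambda>j. h (Matrix.col R j)"]) (auto simp: img)
  ultimately show ?thesis
    unfolding real_cone_def by blast
qed

section \<open>From uniform clutters to matrices with constant column sums\<close>

theorem theorem2p2p6:
  fixes X :: "'a set" and E :: "'a set set"
    and xs :: "'a list" and es :: "'a set list"
    and A :: "int mat" and \<A> :: "real vec set"
  assumes "uniform_clutter X E"
    and "\<forall>x\<in>X. \<not> isolated_vertex E x"
    and "distinct xs" and "set xs = X"
    and "distinct es" and "set es = E"
    and "A = incidence_mat xs es"
    and "\<A> = set (cols (map_mat real_of_int A))"
    and "max_flow_min_cut (map_mat real_of_int A)"
  shows "subdet_gcd (rank_mat A) A = 1 \<and>
    nat_semigroup (length xs) \<A> = real_cone (length xs) \<A> \<inter> integer_lattice (length xs)"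
proof
  let ?n = "length xs" and ?q = "length es"
  define R where "R = map_mat real_of_int A"
  have A: "A \<in> carrier_mat ?n ?q" and R: "R \<in> carrier_mat ?n ?q"
    by (simp_all add: assms(7) R_def incidence_mat_def)
  have A_idx: "A $$ (i, j) = (if xs ! i \<in> es ! j then 1 else 0)" if "i < ?n" "j < ?q" for i j
    using that by (simp add: assms(7) incidence_mat_def)
  have R_idx: "R $$ (i, j) = real_of_int (A $$ (i, j))" if "i < ?n" "j < ?q" for i j
    using that A by (simp add: R_def)
  obtain d where d: "d \<ge> 1" "\<And>e. e \<in> E \<Longrightarrow> card e = d" and sub: "\<And>e. e \<in> E \<Longrightarrow> e \<subseteq> X"
    using assms(1) by (auto simp: uniform_clutter_def clutter_def)
  have nonneg: "A $$ (i, j) \<ge> 0" if "i < ?n" "j < ?q" for i j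
    using that by (simp add: A_idx)
  have col_sum: "(\<Sum>i<?n. A $$ (i, j)) = int d" if j: "j < ?q" for j
  proof -
    have e: "es ! j \<in> E"
      using j assms(6) by auto
    \<comment> \<open>The column sums the indicator of the edge over the vertices, each listed once;
      as the edge lies in \<open>X\<close>, this counts its \<open>d\<close> vertices.\<close>
    have "(\<Sum>i<?n. A $$ (i, j)) = (\<Sum>i<?n. if xs ! i \<in> es ! j then 1 else 0)"
      using j by (intro sum.cong) (simp_all add: A_idx)
    also have "\<dots> = (\<Sum>x\<in>X. if x \<in> es ! j then 1 else 0)"
      using assms(3,4) by (intro sum.reindex_bij_betw bij_betw_nth) auto
    also have "\<dots> = int (card (X \<inter> es ! j))"
      using assms(4) by (subst sum.If_cases) auto
    also have "X \<inter> es ! j = es ! j"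
      using sub[OF e] by blast
    finally show ?thesis
      using d(2)[OF e] by simp
  qed
  have d_pos: "int d > 0"
    using d(1) by simp
  show "subdet_gcd (rank_mat A) A = 1"
    by (rule subdet_gcd_rank_eq_1_if_saturated[OF A])
      (rule max_flow_min_cut_saturated[OF A nonneg col_sum d_pos assms(9)])
  \<comment> \<open>A column determines its edge because all edges lie in \<open>X\<close>; hence
    the distinct edges in \<open>es\<close> give distinct columns.\<close>
  have "es ! j = es ! k" if jk: "j < ?q" "k < ?q" and eq: "Matrix.col R j = Matrix.col R k" for j k
  proof -
    have "xs ! i \<in> es ! j \<longleftrightarrow> xs ! i \<in> es ! k" if "i < ?n" for i
      using arg_cong[OF eq, of "\<lambda>v. v $ i"] that jk R by (auto simp: R_idx A_idx split: if_splits)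
    then have "x \<in> es ! j \<longleftrightarrow> x \<in> es ! k" if "x \<in> X" for x
      using that assms(4) by (metis in_set_conv_nth)
    then show ?thesis
      using sub[of "es ! j"] sub[of "es ! k"] jk assms(6) by (metis nth_mem subsetD subsetI subset_antisym)
  qed
  then have dist: "distinct (cols R)"
    using nth_eq_iff_index_eq[OF assms(5)] carrier_matD[OF R]
    unfolding distinct_conv_nth cols_length by (metis cols_nth)
  have "nat_semigroup ?n (set (cols R)) = real_cone ?n (set (cols R)) \<inter> integer_lattice ?n"
  proof (intro equalityI subsetI)
    fix v assume "v \<in> nat_semigroup ?n (set (cols R))"
    then obtain y where v: "v = vec ?n (\<lambda>i. \<Sum>j<?q. R $$ (i, j) * real (y j))"
      unfolding nat_semigroup_cols[OF R dist] by blast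
    then have "v \<in> real_cone ?n (set (cols R))"
      unfolding real_cone_cols[OF R dist] by fastforce
    moreover have "v \<in> integer_lattice ?n"
      by (auto simp: v integer_lattice_def R_idx intro!: Ints_sum Ints_mult)
    ultimately show "v \<in> real_cone ?n (set (cols R)) \<inter> integer_lattice ?n"
      by blast
  next
    fix v assume v: "v \<in> real_cone ?n (set (cols R)) \<inter> integer_lattice ?n"
    then obtain c where c: "\<And>j. j < ?q \<Longrightarrow> c j \<ge> 0"
      and v_eq: "v = vec ?n (\<lambda>i. \<Sum>j<?q. R $$ (i, j) * c j)"
      unfolding real_cone_cols[OF R dist] by blast
    \<comment> \<open>Membership in the integer lattice makes the floor exact, which turns
      \<open>v\<close> into the integer-valued function that the entrywise form expects.\<close>
    have u: "real_of_int \<lfloor>v $ i\<rfloor> = v $ i" if "i < ?n" for i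
      using v that by (auto simp: integer_lattice_def elim!: Ints_cases)
    have "real_of_int \<lfloor>v $ i\<rfloor> = (\<Sum>j<?q. real_of_int (A $$ (i, j)) * c j)" if "i < ?n" for i
      unfolding u[OF that] using that by (simp add: v_eq R_idx)
    then obtain y where y: "\<And>i. i < ?n \<Longrightarrow> \<lfloor>v $ i\<rfloor> = (\<Sum>j<?q. A $$ (i, j) * int (y j))"
      using max_flow_min_cut_nat_coefficients[OF A nonneg col_sum d_pos assms(9),
          where c = c and u = "\<lambda>i. \<lfloor>v $ i\<rfloor>"] c by blast
    have "v = vec ?n (\<lambda>i. \<Sum>j<?q. R $$ (i, j) * real (y j))"
    proof (rule eq_vecI)
      fix i assume "i < dim_vec (vec ?n (\<lambda>i. \<Sum>j<?q. R $$ (i, j) * real (y j)))"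
      then have i: "i < ?n" by simp
      have "v $ i = real_of_int (\<Sum>j<?q. A $$ (i, j) * int (y j))"
        using u[OF i] y[OF i] by simp
      then show "v $ i = vec ?n (\<lambda>i. \<Sum>j<?q. R $$ (i, j) * real (y j)) $ i"
        using i by (simp add: R_idx)
    qed (simp add: v_eq)
    then show "v \<in> nat_semigroup ?n (set (cols R))"
      unfolding nat_semigroup_cols[OF R dist] by blast
  qed
  then show "nat_semigroup ?n \<A> = real_cone ?n \<A> \<inter> integer_lattice ?n"
    by (simp add: assms(8) R_def)
qed

end
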